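(* Let $u,v\in\mathcal{A}$ be non-constant monomials, written as $u=e_au'$ and $v=e_bv'$ with $a,b\in F$ and $u',v'$ monomials. Then $$\partial(u*v)=(\partial u)*v+u*\partial v+\delta_{a,0}[b]\,(u'*v)+\delta_{b,0}[a]\,(u*v').$$ In particular, for all $u,v\in\mathcal{A}^1$, $$\partial(u*v)=(\partial u)*v+u*\partial v.$$
   Context: Let $F$ be a field and let $\mathcal{A}=\mathcal{A}_F$ be the non-commutative free (unital, associative) algebra over $\mathbb{Z}$ generated by the indeterminates $\{e_p\mid p\in F\}$. A monomial is a word $e_{a_1}\cdots e_{a_n}$; it is non-constant if $n\geq1$. Put $$\mathcal{A}^1=\mathbb{Z}\oplus\bigoplus_{z\in F^\times}e_z\mathcal{A}\subset\mathcal{A}.$$ Fix a group homomorphism $\mathfrak{F}:F^\times\to\mathbb{Z}$ (from the multiplicative group of $F$ to the additive group $\mathbb{Z}$), and for $x\in F$ put $[x]=\mathfrak{F}(x)$ if $x\neq0$ and $[0]=0$. For $s,t\in F$, the $\mathbb{Z}$-linear map $\partial^{s,t}:\mathcal{A}\to\mathcal{A}$ is defined on monomials by $$\partial^{s,t}(e_{a_1}\cdots e_{a_n})=\sum_{i=1}^n\left([a_{i+1}-a_i]-[a_i-a_{i-1}]\right)e_{a_1}\cdots\widehat{e_{a_i}}\cdots e_{a_n},\qquad (a_0,a_{n+1})=(s,t),$$ where the hat means that the factor is omitted (so $\partial^{s,t}(1)=0$). Put $\partial=\partial^{0,1}$. The (generalized) stuffle product $*:\mathcal{A}\times\mathcal{A}\to\mathcal{A}$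 is the $\mathbb{Z}$-bilinear map defined inductively by $w*1=1*w=w$ and $$e_au*e_bv=e_{ab}\left(u*e_bv+e_au*v-e_0(u*v)\right)\qquad(a,b\in F,\ u,v\in\mathcal{A}),$$ where $ab$ is the product in $F$. The symbol $\delta_{x,y}$ is the Kronecker delta. *)

theory Defs
  imports "HOL-Library.Poly_Mapping"
begin

text \<open>
  The free unital associative \<open>\<int>\<close>-algebra on the symbols \<open>e p\<close> (\<open>p :: 'a\<close>) is the monoid algebra
  of the free monoid on \<open>'a\<close>. Since the product of \<^typ>\<open>'b \<Rightarrow>\<^sub>0 int\<close> is convolution along the
  additive monoid of the keys, concatenation of words is made the addition of lists; the
  \<^class>\<open>ring_1\<close> structure on finitely supported functions then supplies the algebra.
\<close>

instantiation list :: (type) monoid_add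
begin

definition zero_list :: "'a list" where "zero_list = []"

definition plus_list :: "'a list \<Rightarrow> 'a list \<Rightarrow> 'a list" where "plus_list = (@)"

instance by standard (simp_all add: zero_list_def plus_list_def)

end

type_synonym 'a free_alg = "'a list \<Rightarrow>\<^sub>0 int"

definition e :: "'a \<Rightarrow> 'a free_alg" where
  "e p = frag_of [p]"

definition monomials :: "'a free_alg set" where
  "monomials = {prod_list (map e w) | w. True}"

lemma prod_list_e_eq_frag_of: "prod_list (map e w) = frag_of w"
proof (induction w)
  case Nil
  then show ?case by (simp add: zero_list_def flip: single_one)
next
  case (Cons a w)
  then show ?case by (simp add: e_def mult_single plus_list_def)
qed

lemma monomials_eq: "monomials = range frag_of"
  by (auto simp: monomials_def prod_list_e_eq_frag_of)

text \<open>\<open>\<A>\<^sup>1 = \<int> \<oplus> \<Oplus>\<^bsub>z \<noteq> 0\<^esub> e\<^sub>z \<A>\<close>\<close>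

definition A1 :: "'a::field free_alg set" where
  "A1 = {of_int c + (\<Sum>z\<in>Z. e z * f z) | c Z f. finite Z \<and> 0 \<notin> Z}"

definition bracket :: "('a::field \<Rightarrow> int) \<Rightarrow> 'a \<Rightarrow> int" where
  "bracket \<FF> x = (if x = 0 then 0 else \<FF> x)"

text \<open>
  With \<open>l = s # w @ [t]\<close> the letter \<open>a\<^sub>j\<close> of the word \<open>w = a\<^sub>1 \<dots> a\<^sub>n\<close> is \<open>l ! j\<close>,
  including \<open>a\<^sub>0 = s\<close> and \<open>a\<^bsub>n+1\<^esub> = t\<close>.
\<close>

definition partial_word :: "('a::field \<Rightarrow> int) \<Rightarrow> 'a \<Rightarrow> 'a \<Rightarrow> 'a list \<Rightarrow> 'a free_alg" where
  "partial_word \<FF> s t w = (let l = s # w @ [t] in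
     \<Sum>i = 1..length w.
       frag_cmul (bracket \<FF> (l ! (i + 1) - l ! i) - bracket \<FF> (l ! i - l ! (i - 1)))
         (frag_of (take (i - 1) w @ drop i w)))"

definition partial_st :: "('a::field \<Rightarrow> int) \<Rightarrow> 'a \<Rightarrow> 'a \<Rightarrow> 'a free_alg \<Rightarrow> 'a free_alg" where
  "partial_st \<FF> s t = frag_extend (partial_word \<FF> s t)"

abbreviation partial :: "('a::field \<Rightarrow> int) \<Rightarrow> 'a free_alg \<Rightarrow> 'a free_alg" where
  "partial \<FF> \<equiv> partial_st \<FF> 0 1"

fun stuffle_word :: "'a::field list \<Rightarrow> 'a list \<Rightarrow> 'a free_alg" where
  "stuffle_word w [] = frag_of w"
| "stuffle_word [] w = frag_of w"
| "stuffle_word (a # u) (b # v) =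
     e (a * b) * (stuffle_word u (b # v) + stuffle_word (a # u) v - e 0 * stuffle_word u v)"

definition stuffle :: "'a::field free_alg \<Rightarrow> 'a free_alg \<Rightarrow> 'a free_alg" (infixl "\<star>" 70) where
  "x \<star> y = frag_extend (\<lambda>u. frag_extend (stuffle_word u) y) x"

text \<open>
  The equations characterising the stuffle product on the whole algebra, beyond words.
\<close>

lemma free_alg_induct [case_names zero one diff]:
  fixes x :: "'b \<Rightarrow>\<^sub>0 int"
  assumes "P 0" "\<And>w. P (frag_of w)" "\<And>x y. P x \<Longrightarrow> P y \<Longrightarrow> P (x - y)"
  shows "P x"
  by (rule frag_induction[of x UNIV P]) (use assms in auto)

lemma stuffle_add_left: "(x + y) \<star> z = x \<star> z + y \<star> z"
  by (simp add: stuffle_def frag_extend_add)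

lemma stuffle_diff_left: "(x - y) \<star> z = x \<star> z - y \<star> z"
  by (simp add: stuffle_def frag_extend_diff)

lemma stuffle_diff_right: "x \<star> (y - z) = x \<star> y - x \<star> z"
  by (induction x rule: free_alg_induct)
     (simp_all add: stuffle_def frag_extend_diff)

lemma stuffle_zero_left: "0 \<star> x = 0"
  by (simp add: stuffle_def)

lemma stuffle_zero_right: "x \<star> 0 = 0"
  using stuffle_diff_right[of x 0 0] by simp

lemma one_free_alg: "(1 :: 'a free_alg) = frag_of []"
  by (simp add: zero_list_def flip: single_one)

lemma e_times_frag_of: "e a * frag_of w = frag_of (a # w)"
  by (simp add: e_def mult_single plus_list_def)

lemma stuffle_one_right: "x \<star> 1 = x"
  by (induction x rule: free_alg_induct)
     (simp_all add: stuffle_zero_left stuffle_diff_left, simp add: stuffle_def one_free_alg)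

lemma stuffle_word_Nil_left: "stuffle_word [] w = frag_of w"
  by (cases w) simp_all

lemma stuffle_one_left: "1 \<star> x = x"
  by (induction x rule: free_alg_induct)
     (simp_all add: stuffle_zero_right stuffle_diff_right,
      simp add: stuffle_def one_free_alg stuffle_word_Nil_left)

lemma stuffle_rec:
  "(e a * x) \<star> (e b * y) = e (a * b) * (x \<star> (e b * y) + (e a * x) \<star> y - e 0 * (x \<star> y))"
proof (induction x rule: free_alg_induct)
  case (one u)
  show ?case
  proof (induction y rule: free_alg_induct)
    case (one v)
    show ?case by (simp add: e_times_frag_of) (simp add: stuffle_def)
  qed (simp_all add: stuffle_zero_right stuffle_diff_right algebra_simps)
qed (simp_all add: stuffle_zero_left stuffle_diff_left algebra_simps)

end

theory Submission
  imports Defs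
begin

text \<open>
  Peeling off the first letter turns the differential into a recursion,
  \<open>\<partial>(e\<^sub>c x) = e\<^sub>c \<partial>x + J\<^sub>c x - [c] x\<close>, in which the linear operator \<open>J\<^sub>c\<close> (\<open>junction\<close>)
  looks only at the first letter of \<open>x\<close>. The stuffle product is also defined by peeling off
  first letters, so \<open>\<partial>(u * v)\<close> can be computed by induction. After the induction hypothesis has
  been used, every term containing a \<open>\<partial>\<close> cancels, and what remains is an identity between the
  \<open>J\<^sub>c\<close>, the weight \<open>J\<^sub>0\<close>, which multiplies \<open>e\<^sub>b w\<close> by \<open>[b]\<close>, and the correction
  terms (\<open>first_letter_identity\<close>).

  The correction terms become manageable when written bilinearly. Let \<open>T\<close> (\<open>drop_head_zero\<close>) send
  \<open>e\<^sub>0 w\<close> to \<open>w\<close> and all other words to \<open>0\<close>. For \<open>u = e\<^sub>a u'\<close> and \<open>v = e\<^sub>b v'\<close>,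
  \<open>\<delta>\<^bsub>a,0\<^esub> [b] (u' * v) + \<delta>\<^bsub>b,0\<^esub> [a] (u * v') = Tu * J\<^sub>0 v + J\<^sub>0 u * Tv\<close>,
  and the right-hand side (\<open>leibniz_defect\<close>) makes sense for all \<open>u\<close> and \<open>v\<close>, constants included.
  The Leibniz rule with this defect holds on the whole algebra (\<open>partial_stuffle\<close>). On \<open>\<A>\<^sup>1\<close> the
  operator \<open>T\<close> vanishes, so the defect disappears there.

  The remaining identity follows from two facts. First, \<open>e\<^sub>0\<close> times the defect is the failure of
  \<open>J\<^sub>0\<close> itself to be a derivation (\<open>head_weight_stuffle\<close>), because
  \<open>[pq] = [p] + [q]\<close> can break down only when \<open>p\<close> or \<open>q\<close> is \<open>0\<close>. Second, for nonzero \<open>a\<close> and \<open>b\<close>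
  the value of \<open>J\<^bsub>ab\<^esub>\<close> on \<open>x * e\<^sub>b y\<close> is expressed through \<open>J\<^sub>a x\<close>
  (\<open>junction_stuffle\<close>), since the first letters of that product are \<open>pb\<close> with \<open>p\<close> a first letter
  of \<open>x\<close> and \<open>[pb - ab] = [p - a] + [b]\<close> unless \<open>p = a\<close>.
\<close>

section \<open>Linearity and the stuffle product\<close>

text \<open>
  Induction on words, phrased for elements of the algebra. All maps involved are linear and are
  computed from the first letter, so the identities below need no reference to words as lists.
\<close>

lemma free_alg_letter_induct [case_names zero unit letter diff]:
  assumes "P 0" "P 1" "\<And>a x. P x \<Longrightarrow> P (e a * x)" "\<And>x y. P x \<Longrightarrow> P y \<Longrightarrow> P (x - y)"
  shows "P x"
proof (induction x rule: free_alg_induct)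
  case (one w)
  then show ?case
    by (induction w) (use assms in \<open>auto simp: one_free_alg simp flip: e_times_frag_of\<close>)
qed (use assms in auto)

lemma frag_cmul_of_int: "frag_cmul k x = of_int k * (x :: 'a free_alg)"
proof (induction k rule: int_induct[where k = 0])
qed (simp_all add: frag_cmul_distrib frag_cmul_diff_distrib algebra_simps)

lemma frag_cmul_diff_right: "frag_cmul k (x - y) = frag_cmul k x - frag_cmul k y"
  by (rule poly_mapping_eqI) (simp add: lookup_minus algebra_simps)

lemma frag_cmul_minus_left: "frag_cmul (- k) x = - frag_cmul k x"
  by simp

text \<open>
  The library turns negatives into negative scalars; here they are moved out of the scalars instead,
  so that opposite terms cancel as elements of an abelian group.
\<close>

declare minus_frag_cmul [simp del]

lemma mult_frag_cmul: "(x :: 'a free_alg) * frag_cmul k y = frag_cmul k (x * y)"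
  by (metis frag_cmul_of_int mult.assoc mult_of_int_commute)

lemma stuffle_frag_cmul_left: "frag_cmul k x \<star> y = frag_cmul k (x \<star> y)"
  by (simp add: stuffle_def frag_extend_cmul)

lemma stuffle_add_right: "x \<star> (y + z) = x \<star> y + x \<star> z"
  using stuffle_diff_right[of x "y + z" z] by simp

lemma stuffle_frag_cmul_right: "x \<star> frag_cmul k y = frag_cmul k (x \<star> y)"
  by (induction x rule: free_alg_induct)
     (simp_all add: stuffle_zero_left stuffle_diff_left frag_cmul_diff_right,
      simp add: stuffle_def frag_extend_cmul)

lemmas linear_simps =
  frag_cmul_minus_left frag_cmul_distrib frag_cmul_distrib2 frag_cmul_diff_distrib
  frag_cmul_diff_right mult_frag_cmul
  stuffle_zero_left stuffle_zero_right stuffle_one_left stuffle_one_right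
  stuffle_add_left stuffle_add_right stuffle_diff_left stuffle_diff_right
  stuffle_frag_cmul_left stuffle_frag_cmul_right

lemma stuffle_commute: "x \<star> y = y \<star> x"
proof (induction x arbitrary: y rule: free_alg_letter_induct)
  case (letter a x)
  note IH = this
  show ?case
  proof (induction y rule: free_alg_letter_induct)
    case (letter b y)
    show ?case
      by (simp add: stuffle_rec IH[of "e b * y"] IH[of y] letter mult.commute[of b a] algebra_simps)
  qed (simp_all add: linear_simps)
qed (simp_all add: linear_simps)

text \<open>
  With \<open>a = 0\<close> the last two summands of the stuffle recursion cancel by induction. Hence \<open>e\<^sub>0\<close>
  can be pulled out of either factor of a product.
\<close>

lemma e_zero_stuffle: "(e 0 * x) \<star> y = e 0 * (x \<star> y)"
  by (induction y rule: free_alg_letter_induct) (simp_all add: linear_simps stuffle_rec algebra_simps)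

lemma stuffle_e_zero: "x \<star> (e 0 * y) = e 0 * (x \<star> y)"
  by (metis stuffle_commute e_zero_stuffle)

section \<open>The differential\<close>

text \<open>
  The terms of \<open>\<partial>(e\<^sub>c x)\<close> that depend on the meeting point of \<open>e\<^sub>c\<close> and \<open>x\<close>. If \<open>x = e\<^sub>b w\<close>, then
  omitting \<open>c\<close> contributes \<open>[b - c] e\<^sub>b w\<close>, besides the term \<open>-[c] x\<close> that does
  not depend on \<open>b\<close>. Omitting \<open>b\<close> contributes with \<open>-[b - c]\<close>, as the left neighbour of \<open>b\<close> is \<open>c\<close>, whereas \<open>e\<^sub>c \<partial>x\<close> counts it with \<open>-[b - 0]\<close>; the second summand is
  this difference. If \<open>x\<close> is constant, the right neighbour of \<open>c\<close> is the end point \<open>1\<close>.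
\<close>

definition junction :: "('a::field \<Rightarrow> int) \<Rightarrow> 'a \<Rightarrow> 'a free_alg \<Rightarrow> 'a free_alg" where
  "junction \<FF> c = frag_extend (\<lambda>w. case w of
     [] \<Rightarrow> frag_cmul (bracket \<FF> (1 - c)) 1
   | b # w' \<Rightarrow> frag_cmul (bracket \<FF> (b - c)) (frag_of w)
              + frag_cmul (bracket \<FF> b - bracket \<FF> (b - c)) (frag_of (c # w')))"

abbreviation head_weight :: "('a::field \<Rightarrow> int) \<Rightarrow> 'a free_alg \<Rightarrow> 'a free_alg" where
  "head_weight \<FF> \<equiv> junction \<FF> 0"

definition drop_head_zero :: "'a::field free_alg \<Rightarrow> 'a free_alg" where
  "drop_head_zero = frag_extend (\<lambda>w. case w of
     [] \<Rightarrow> 0 | b # w' \<Rightarrow> frag_cmul (of_bool (b = 0)) (frag_of w'))"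

lemma junction_zero [simp]: "junction \<FF> c 0 = 0"
  and junction_add: "junction \<FF> c (x + y) = junction \<FF> c x + junction \<FF> c y"
  and junction_diff: "junction \<FF> c (x - y) = junction \<FF> c x - junction \<FF> c y"
  and junction_one: "junction \<FF> c 1 = frag_cmul (bracket \<FF> (1 - c)) 1"
  by (simp_all add: junction_def frag_extend_add frag_extend_diff frag_extend_cmul one_free_alg)

lemma junction_letter:
  "junction \<FF> c (e b * x) = frag_cmul (bracket \<FF> (b - c)) (e b * x)
     + frag_cmul (bracket \<FF> b - bracket \<FF> (b - c)) (e c * x)"
proof (induction x rule: free_alg_induct)
  case (one w)
  show ?case by (simp add: e_times_frag_of) (simp add: junction_def)
qed (simp_all add: linear_simps junction_diff algebra_simps)

lemma drop_head_zero_zero [simp]: "drop_head_zero 0 = 0"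
  and drop_head_zero_add: "drop_head_zero (x + y) = drop_head_zero x + drop_head_zero y"
  and drop_head_zero_diff: "drop_head_zero (x - y) = drop_head_zero x - drop_head_zero y"
  and drop_head_zero_frag_cmul: "drop_head_zero (frag_cmul k x) = frag_cmul k (drop_head_zero x)"
  and drop_head_zero_one: "drop_head_zero 1 = 0"
  by (simp_all add: drop_head_zero_def frag_extend_add frag_extend_diff frag_extend_cmul one_free_alg)

lemma drop_head_zero_letter: "drop_head_zero (e b * x) = frag_cmul (of_bool (b = 0)) x"
proof (induction x rule: free_alg_induct)
  case (one w)
  show ?case by (simp add: e_times_frag_of) (simp add: drop_head_zero_def)
qed (simp_all add: linear_simps drop_head_zero_diff algebra_simps)

text \<open>
  Splitting off the term that omits the first letter \<open>a\<close>. In all other terms \<open>a\<close> survives in front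
  and acts as the left end point of the remaining word.
\<close>

lemma partial_word_Cons:
  "partial_word \<FF> s t (a # w) =
     frag_cmul (bracket \<FF> (hd (w @ [t]) - a) - bracket \<FF> (a - s)) (frag_of w)
     + e a * partial_word \<FF> a t w"
proof -
  define g where "g s w i = frag_cmul (bracket \<FF> ((s # w @ [t]) ! (i + 1) - (s # w @ [t]) ! i)
      - bracket \<FF> ((s # w @ [t]) ! i - (s # w @ [t]) ! (i - 1)))
    (frag_of (take (i - 1) w @ drop i w))" for s w i
  have word: "partial_word \<FF> s t w = (\<Sum>i = 1..length w. g s w i)" for s w
    by (simp add: partial_word_def g_def Let_def)
  have later: "g s (a # w) (Suc i) = e a * g a w i" if range: "i \<in> {1..length w}" for i
  proof -
    obtain k where "i = Suc k"
      using range by (cases i) auto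
    then show ?thesis
      by (simp add: g_def mult_frag_cmul e_times_frag_of)
  qed
  have "partial_word \<FF> s t (a # w) = (\<Sum>i = 1..Suc (length w). g s (a # w) i)"
    by (simp only: word length_Cons)
  also have "\<dots> = g s (a # w) 1 + (\<Sum>i = 1..length w. g s (a # w) (Suc i))"
    using sum.atLeast_Suc_atMost[of 1 "Suc (length w)" "g s (a # w)"]
    by (simp add: sum.shift_bounds_cl_Suc_ivl del: sum.cl_ivl_Suc)
  also have "(\<Sum>i = 1..length w. g s (a # w) (Suc i)) = (\<Sum>i = 1..length w. e a * g a w i)"
    by (rule sum.cong[OF refl]) (rule later)
  also have "g s (a # w) 1 =
      frag_cmul (bracket \<FF> (hd (w @ [t]) - a) - bracket \<FF> (a - s)) (frag_of w)"
    by (simp add: g_def hd_conv_nth)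
  finally show ?thesis
    by (simp only: word sum_distrib_left)
qed

lemma partial_zero [simp]: "partial_st \<FF> s t 0 = 0"
  and partial_add: "partial_st \<FF> s t (x + y) = partial_st \<FF> s t x + partial_st \<FF> s t y"
  and partial_diff: "partial_st \<FF> s t (x - y) = partial_st \<FF> s t x - partial_st \<FF> s t y"
  and partial_one: "partial_st \<FF> s t 1 = 0"
  by (simp_all add: partial_st_def frag_extend_add frag_extend_diff frag_extend_cmul one_free_alg
      partial_word_def)

text \<open>
  The recursion by which \<open>\<partial>\<close> enters the proof of the Leibniz rule: it keeps the left end point at
  \<open>0\<close>, at the price of the correction contained in \<open>junction\<close>.
\<close>

lemma partial_letter:
  "partial \<FF> (e c * x) = e c * partial \<FF> x + junction \<FF> c x - frag_cmul (bracket \<FF> c) x"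
proof (induction x rule: free_alg_induct)
  case (one w)
  have "partial_word \<FF> 0 1 (c # w) =
      e c * partial_word \<FF> 0 1 w + junction \<FF> c (frag_of w) - frag_cmul (bracket \<FF> c) (frag_of w)"
  proof (cases w)
    case Nil
    then show ?thesis
      by (simp add: partial_word_Cons junction_def one_free_alg linear_simps)
         (simp add: partial_word_def)
  next
    case (Cons b w')
    then show ?thesis
      by (simp add: partial_word_Cons linear_simps junction_letter algebra_simps flip: e_times_frag_of)
  qed
  then show ?case by (simp add: e_times_frag_of) (simp add: partial_st_def)
next
  case (diff x y)
  then show ?case
    by (simp only: right_diff_distrib partial_diff junction_diff frag_cmul_diff_right)
       (simp add: algebra_simps)
qed simp

lemmas operator_simps =
  junction_add junction_diff junction_one
  drop_head_zero_add drop_head_zero_diff drop_head_zero_one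
  partial_add partial_diff partial_one

section \<open>The Leibniz rule\<close>

locale units_hom =
  fixes \<FF> :: "'a::field \<Rightarrow> int"
  assumes hom: "\<And>x y. x \<noteq> 0 \<Longrightarrow> y \<noteq> 0 \<Longrightarrow> \<FF> (x * y) = \<FF> x + \<FF> y"
begin

lemma bracket_zero [simp]: "bracket \<FF> 0 = 0"
  by (simp add: bracket_def)

lemma bracket_one [simp]: "bracket \<FF> 1 = 0"
  using hom[of 1 1] by (simp add: bracket_def)

lemma bracket_mult: "x \<noteq> 0 \<Longrightarrow> y \<noteq> 0 \<Longrightarrow> bracket \<FF> (x * y) = bracket \<FF> x + bracket \<FF> y"
  by (simp add: bracket_def hom)

text \<open>
  \<open>-1\<close> is a root of unity and \<open>\<int>\<close> is torsion-free, so \<open>[-1] = 0\<close>.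
\<close>

lemma bracket_minus [simp]: "bracket \<FF> (- x) = bracket \<FF> x"
proof -
  have "\<FF> (- 1) = 0"
    using hom[of "- 1" "- 1"] hom[of 1 1] by simp
  then show ?thesis
    using hom[of "- 1" x] by (simp add: bracket_def)
qed

text \<open>
  The correction terms of the Leibniz rule in bilinear form. For \<open>x = e\<^sub>a x'\<close> and \<open>y = e\<^sub>b y'\<close> the
  operator \<open>drop_head_zero\<close> supplies the Kronecker deltas and the omission of the first letter, and
  \<open>head_weight\<close> supplies the factors \<open>[b]\<close> and \<open>[a]\<close>.
\<close>

definition leibniz_defect :: "'a free_alg \<Rightarrow> 'a free_alg \<Rightarrow> 'a free_alg" where
  "leibniz_defect x y = drop_head_zero x \<star> head_weight \<FF> y + head_weight \<FF> x \<star> drop_head_zero y"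

lemma leibniz_defect_commute: "leibniz_defect x y = leibniz_defect y x"
  by (simp add: leibniz_defect_def stuffle_commute add.commute)

text \<open>
  All words in \<open>e\<^sub>p x' * e\<^sub>q y'\<close> begin with \<open>pq\<close>, so \<open>head_weight\<close> is a derivation on this product
  if \<open>[pq] = [p] + [q]\<close>. If, say, \<open>p = 0\<close> and \<open>q \<noteq> 0\<close>, the weight \<open>[pq]\<close> is \<open>0\<close> instead of \<open>[q]\<close>, and
  the missing \<open>[q] (e\<^sub>0 x' * e\<^sub>q y')\<close> is \<open>e\<^sub>0\<close> times the defect by \<open>e_zero_stuffle\<close>.
\<close>

lemma head_weight_stuffle:
  "head_weight \<FF> (x \<star> y) = head_weight \<FF> x \<star> y + x \<star> head_weight \<FF> y
     - e 0 * leibniz_defect x y"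
  unfolding leibniz_defect_def
proof (induction x rule: free_alg_letter_induct)
  case (letter a x)
  show ?case
  proof (induction y rule: free_alg_letter_induct)
    case (letter b y)
    show ?case
      by (cases "a = 0"; cases "b = 0")
        (simp_all add: stuffle_rec junction_letter drop_head_zero_letter linear_simps operator_simps
          bracket_mult e_zero_stuffle stuffle_e_zero algebra_simps)
  qed (simp_all add: linear_simps operator_simps algebra_simps)
qed (simp_all add: linear_simps operator_simps algebra_simps)

text \<open>
  For \<open>x = e\<^sub>p x'\<close> the product \<open>x * e\<^sub>b y\<close> equals \<open>e\<^bsub>pb\<^esub> w\<close>, on which \<open>J\<^bsub>ab\<^esub>\<close> produces the brackets
  \<open>[pb - ab]\<close> and \<open>[pb]\<close>. They split off \<open>[b]\<close> and become the brackets of \<open>J\<^sub>a x\<close>, except in two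
  cases. For \<open>p = a\<close> the two failing instances compensate each other, because then \<open>e\<^bsub>pb\<^esub> w\<close> and
  \<open>e\<^bsub>ab\<^esub> w\<close> coincide. For \<open>p = 0\<close> the failure is the last term, which is the part of the defect
  attached to \<open>x\<close>.
\<close>

lemma junction_stuffle:
  assumes "a \<noteq> 0" "b \<noteq> 0"
  shows "junction \<FF> (a * b) (x \<star> (e b * y)) =
     frag_cmul (bracket \<FF> b) (x \<star> (e b * y)) + junction \<FF> a x \<star> (e b * y)
     - e (a * b) * (junction \<FF> a x \<star> y)
     + e (a * b) * (head_weight \<FF> x \<star> y)
     - frag_cmul (bracket \<FF> b) (e (a * b) * (drop_head_zero x \<star> (e b * y)))"
proof (induction x rule: free_alg_letter_induct)
  case unit
  have "bracket \<FF> (b - a * b) = (if a = 1 then 0 else bracket \<FF> b + bracket \<FF> (1 - a))"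
    using bracket_mult[of b "1 - a"] assms by (auto simp: algebra_simps)
  then show ?case
    by (simp add: linear_simps operator_simps junction_letter algebra_simps)
next
  case (letter p x)
  have shift: "bracket \<FF> (p * b - a * b) = (if p = a then 0 else bracket \<FF> b + bracket \<FF> (p - a))"
    using bracket_mult[of "p - a" b] assms by (auto simp: algebra_simps)
  show ?case
    by (cases "p = 0"; cases "p = a")
      (use assms in \<open>simp_all add: linear_simps operator_simps stuffle_rec junction_letter
        drop_head_zero_letter bracket_mult shift
        shift[unfolded mult.commute[of p b]] e_zero_stuffle algebra_simps\<close>)
qed (simp_all add: linear_simps operator_simps algebra_simps)

text \<open>
  The next lemma with \<open>a = 0\<close> substituted. Here \<open>e\<^sub>0\<close> can be pulled out of every product with
  \<open>u = e\<^sub>0 x\<close>, and \<open>J\<^bsub>ab\<^esub>\<close> is \<open>head_weight\<close>, whose values on products are known.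
\<close>

lemma first_letter_identity_zero:
  fixes b :: 'a and x y :: "'a free_alg"
  defines "v \<equiv> e b * y"
  shows "e 0 * (x \<star> junction \<FF> b y + head_weight \<FF> x \<star> y - frag_cmul (bracket \<FF> b) (x \<star> y)
           + leibniz_defect x v + leibniz_defect (e 0 * x) y - head_weight \<FF> x \<star> y - x \<star> head_weight \<FF> y)
       + head_weight \<FF> (x \<star> v + (e 0 * x) \<star> y - e 0 * (x \<star> y))
     = head_weight \<FF> x \<star> v + (e 0 * x) \<star> junction \<FF> b y
       - frag_cmul (bracket \<FF> b) ((e 0 * x) \<star> y) + leibniz_defect (e 0 * x) v"
  by (simp add: v_def leibniz_defect_def e_zero_stuffle head_weight_stuffle junction_letter drop_head_zero_letter
      linear_simps algebra_simps)

text \<open>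
  What the Leibniz rule for \<open>u = e\<^sub>a x\<close> and \<open>v = e\<^sub>b y\<close> amounts to once it is known for the pairs
  \<open>(x, v)\<close>, \<open>(u, y)\<close> and \<open>(x, y)\<close>: both sides are expanded with \<open>partial_letter\<close> and the stuffle
  recursion, the defect of \<open>(x, y)\<close> is replaced by \<open>head_weight_stuffle\<close>, and the terms
  containing \<open>\<partial>x\<close> or \<open>\<partial>y\<close> cancel. For nonzero \<open>a\<close> and \<open>b\<close> the products \<open>x * v\<close> and \<open>u * y\<close> in \<open>z\<close>
  are treated by \<open>junction_stuffle\<close> and its mirror image.
\<close>

lemma first_letter_identity:
  fixes a b :: 'a and x y :: "'a free_alg"
  defines "u \<equiv> e a * x" and "v \<equiv> e b * y"
  defines "z \<equiv> x \<star> v + u \<star> y - e 0 * (x \<star> y)"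
  shows "e (a * b) * (x \<star> junction \<FF> b y + junction \<FF> a x \<star> y
           - frag_cmul (bracket \<FF> a + bracket \<FF> b) (x \<star> y)
           + leibniz_defect x v + leibniz_defect u y - head_weight \<FF> x \<star> y - x \<star> head_weight \<FF> y)
       + junction \<FF> (a * b) z - frag_cmul (bracket \<FF> (a * b)) z
     = junction \<FF> a x \<star> v - frag_cmul (bracket \<FF> a) (x \<star> v)
       + u \<star> junction \<FF> b y - frag_cmul (bracket \<FF> b) (u \<star> y) + leibniz_defect u v"
proof -
  consider "a = 0" | "b = 0" | "a \<noteq> 0" "b \<noteq> 0" by blast
  then show ?thesis
  proof cases
    case 1
    then show ?thesis
      using first_letter_identity_zero[of x b y] by (simp add: u_def v_def z_def)
  next
    case 2
    then show ?thesis
      using first_letter_identity_zero[of y a x]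
      by (simp add: u_def v_def z_def stuffle_commute[of y] stuffle_commute[of "e 0 * y"]
         stuffle_commute[of "head_weight \<FF> y"]
         leibniz_defect_commute[of y] leibniz_defect_commute[of "e 0 * y"] algebra_simps)
  next
    case 3
    have "junction \<FF> (a * b) (u \<star> y) =
       frag_cmul (bracket \<FF> a) (u \<star> y) + u \<star> junction \<FF> b y
       - e (a * b) * (x \<star> junction \<FF> b y) + e (a * b) * (x \<star> head_weight \<FF> y)
       - frag_cmul (bracket \<FF> a) (e (a * b) * (u \<star> drop_head_zero y))"
      using junction_stuffle[OF 3(2,1), of y x]
      by (simp add: u_def mult.commute[of b a] stuffle_commute[of y] stuffle_commute[of "junction \<FF> b y"]
          stuffle_commute[of "head_weight \<FF> y"] stuffle_commute[of "drop_head_zero y"])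
    moreover have "junction \<FF> (a * b) (x \<star> v) =
       frag_cmul (bracket \<FF> b) (x \<star> v) + junction \<FF> a x \<star> v
       - e (a * b) * (junction \<FF> a x \<star> y) + e (a * b) * (head_weight \<FF> x \<star> y)
       - frag_cmul (bracket \<FF> b) (e (a * b) * (drop_head_zero x \<star> v))"
      using junction_stuffle[OF 3, of x y] by (simp add: v_def)
    ultimately show ?thesis
      using 3
      by (simp add: z_def junction_add junction_diff)
         (simp add: u_def v_def junction_letter drop_head_zero_letter
          linear_simps bracket_mult leibniz_defect_def algebra_simps)
  qed
qed

theorem partial_stuffle:
  "partial \<FF> (x \<star> y) = partial \<FF> x \<star> y + x \<star> partial \<FF> y + leibniz_defect x y"
proof (induction x arbitrary: y rule: free_alg_letter_induct)
  case (letter a x)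
  note IH = this
  show ?case
  proof (induction y rule: free_alg_letter_induct)
    case (letter b y)
    define u v where "u = e a * x" and "v = e b * y"
    define z where "z = x \<star> v + u \<star> y - e 0 * (x \<star> y)"
    have uv: "u \<star> v = e (a * b) * z"
      by (simp add: u_def v_def z_def stuffle_rec)
    have partial_u: "partial \<FF> u = e a * partial \<FF> x + junction \<FF> a x - frag_cmul (bracket \<FF> a) x"
      and partial_v: "partial \<FF> v = e b * partial \<FF> y + junction \<FF> b y - frag_cmul (bracket \<FF> b) y"
      by (simp_all add: u_def v_def partial_letter)
    \<comment> \<open>The defect of \<open>(x, y)\<close> cancels against that of \<open>head_weight\<close> as a derivation.\<close>
    have "partial \<FF> (e 0 * (x \<star> y)) = e 0 * (partial \<FF> x \<star> y + x \<star> partial \<FF> y)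
        + head_weight \<FF> x \<star> y + x \<star> head_weight \<FF> y"
      by (simp add: partial_letter IH head_weight_stuffle leibniz_defect_def algebra_simps)
    then have partial_z: "partial \<FF> z = partial \<FF> x \<star> v + x \<star> partial \<FF> v + leibniz_defect x v
        + partial \<FF> u \<star> y + u \<star> partial \<FF> y + leibniz_defect u y
        - (e 0 * (partial \<FF> x \<star> y + x \<star> partial \<FF> y)
        + head_weight \<FF> x \<star> y + x \<star> head_weight \<FF> y)"
      using IH[of v] letter.IH by (simp add: z_def u_def partial_add partial_diff)
    have left: "(e a * partial \<FF> x) \<star> v = e (a * b) *
        (partial \<FF> x \<star> v + (e a * partial \<FF> x) \<star> y - e 0 * (partial \<FF> x \<star> y))"
      and right: "u \<star> (e b * partial \<FF> y) = e (a * b) *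
        (x \<star> (e b * partial \<FF> y) + u \<star> partial \<FF> y - e 0 * (x \<star> partial \<FF> y))"
      by (simp_all add: u_def v_def stuffle_rec)
    have "partial \<FF> (u \<star> v) =
        e (a * b) * partial \<FF> z + junction \<FF> (a * b) z - frag_cmul (bracket \<FF> (a * b)) z"
      by (simp add: uv partial_letter)
    also have "\<dots> = partial \<FF> u \<star> v + u \<star> partial \<FF> v + leibniz_defect u v"
      using first_letter_identity[of a b x y, folded u_def v_def, folded z_def]
      by (simp add: partial_z partial_u partial_v linear_simps left right algebra_simps)
    finally show ?case
      by (simp add: u_def v_def)
  qed (simp_all add: linear_simps leibniz_defect_def operator_simps algebra_simps)
qed (simp_all add: linear_simps leibniz_defect_def operator_simps algebra_simps)

end

lemma drop_head_zero_A1: "u \<in> A1 \<Longrightarrow> drop_head_zero u = 0"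
proof -
  assume "u \<in> A1"
  then obtain c Z f where "finite Z" "0 \<notin> Z" and u: "u = of_int c + (\<Sum>z\<in>Z. e z * f z)"
    by (auto simp: A1_def)
  have "drop_head_zero (of_int c) = 0"
    using drop_head_zero_frag_cmul[of c 1] by (simp add: frag_cmul_of_int drop_head_zero_one)
  moreover have "drop_head_zero (\<Sum>z\<in>Z. e z * f z) = 0"
    using \<open>finite Z\<close> \<open>0 \<notin> Z\<close>
    by (induction Z rule: finite_induct) (auto simp: drop_head_zero_add drop_head_zero_letter)
  ultimately show ?thesis by (simp add: u drop_head_zero_add)
qed

theorem theorem8:
  fixes \<FF> :: "'a::field \<Rightarrow> int"
  assumes hom: "\<And>x y. x \<noteq> 0 \<Longrightarrow> y \<noteq> 0 \<Longrightarrow> \<FF> (x * y) = \<FF> x + \<FF> y"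
  shows "(\<forall>a b. \<forall>u' \<in> monomials. \<forall>v' \<in> monomials. \<forall>u v. u = e a * u' \<longrightarrow> v = e b * v' \<longrightarrow>
            partial \<FF> (u \<star> v) =
              partial \<FF> u \<star> v + u \<star> partial \<FF> v
              + frag_cmul (of_bool (a = 0) * bracket \<FF> b) (u' \<star> v)
              + frag_cmul (of_bool (b = 0) * bracket \<FF> a) (u \<star> v'))
       \<and> (\<forall>u \<in> A1. \<forall>v \<in> A1. partial \<FF> (u \<star> v) = partial \<FF> u \<star> v + u \<star> partial \<FF> v)"
proof -
  interpret units_hom \<FF>
    by unfold_locales (rule hom)
  have "leibniz_defect (e a * u') (e b * v') = frag_cmul (of_bool (a = 0) * bracket \<FF> b) (u' \<star> (e b * v'))
      + frag_cmul (of_bool (b = 0) * bracket \<FF> a) ((e a * u') \<star> v')" for a b u' v'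
    by (simp add: leibniz_defect_def drop_head_zero_letter junction_letter linear_simps)
  moreover have "leibniz_defect u v = 0" if "u \<in> A1" "v \<in> A1" for u v
    using that by (simp add: leibniz_defect_def drop_head_zero_A1 linear_simps)
  ultimately show ?thesis
    by (simp add: partial_stuffle add.assoc)
qed

end
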